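(* Let $G=(V,E)$ be a graph. For an edge $e\in E$ let $t(e)$ be the number of triangles of $G$ containing $e$, and let $T=\max_{e\in E}t(e)$. Then $\mathrm{Ric}(G)\le 2+\frac{T}{2}$.
   Context: Graphs are undirected, simple, locally finite, with no isolated vertices; write $y\sim x$ if $\{x,y\}\in E$. For $f,g:V\to\mathbb R$ define $\Delta f(x)=\sum_{y\sim x}(f(y)-f(x))$, $\Gamma(f,g)(x)=\frac12\sum_{y\sim x}(f(x)-f(y))(g(x)-g(y))$, $\Gamma(f)=\Gamma(f,f)$, $\Gamma_2(f)=\frac12\Delta\Gamma(f)-\Gamma(f,\Delta f)$. The curvature $\mathrm{Ric}(G)$ is the largest $K\in\mathbb R$ such that $\Gamma_2(f)(x)\ge K\,\Gamma(f)(x)$ for all $f:V\to\mathbb R$ and all $x\in V$. *)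

theory Defs
  imports "HOL-Library.Extended_Real"
begin

definition nbrs :: "'a set set \<Rightarrow> 'a \<Rightarrow> 'a set" where
  "nbrs E x = {y. {x, y} \<in> E}"

text \<open>The vertex set is required to be nonempty: otherwise there is no edge, and neither
  the curvature nor the maximal number of triangles is defined.\<close>

locale lf_graph =
  fixes V :: "'a set" and E :: "'a set set"
  assumes nonempty: "V \<noteq> {}"
    and simple_edges: "e \<in> E \<Longrightarrow> e \<subseteq> V \<and> card e = 2"
    and locally_finite: "x \<in> V \<Longrightarrow> finite (nbrs E x)"
    and no_isolated: "x \<in> V \<Longrightarrow> nbrs E x \<noteq> {}"

text \<open>Functions on \<^term>\<open>V\<close> are represented by functions on the whole type; at a vertex,
  the operators below only use the values at vertices of the graph.\<close>

definition laplacian :: "'a set set \<Rightarrow> ('a \<Rightarrow> real) \<Rightarrow> 'a \<Rightarrow> real" where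
  "laplacian E f x = (\<Sum>y\<in>nbrs E x. f y - f x)"

definition Gam :: "'a set set \<Rightarrow> ('a \<Rightarrow> real) \<Rightarrow> ('a \<Rightarrow> real) \<Rightarrow> 'a \<Rightarrow> real" where
  "Gam E f g x = 1/2 * (\<Sum>y\<in>nbrs E x. (f x - f y) * (g x - g y))"

definition Gam2 :: "'a set set \<Rightarrow> ('a \<Rightarrow> real) \<Rightarrow> 'a \<Rightarrow> real" where
  "Gam2 E f x = 1/2 * laplacian E (Gam E f f) x - Gam E f (laplacian E f) x"

definition curv_bound :: "'a set \<Rightarrow> 'a set set \<Rightarrow> real \<Rightarrow> bool" where
  "curv_bound V E K \<longleftrightarrow> (\<forall>f. \<forall>x\<in>V. Gam2 E f x \<ge> K * Gam E f f x)"

text \<open>The largest curvature bound. On a graph of unbounded degree there may be no real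
  curvature bound at all; the curvature is then \<^term>\<open>-\<infinity> :: ereal\<close>. In all other cases
  the supremum is a real number and is attained, see \<open>ric_greatest\<close> below.\<close>

definition ric :: "'a set \<Rightarrow> 'a set set \<Rightarrow> ereal" where
  "ric V E = Sup {ereal K | K. curv_bound V E K}"

definition triangles :: "'a set set \<Rightarrow> 'a set set" where
  "triangles E = {S. card S = 3 \<and> (\<forall>x\<in>S. \<forall>y\<in>S. x \<noteq> y \<longrightarrow> {x, y} \<in> E)}"

definition tri_count :: "'a set set \<Rightarrow> 'a set \<Rightarrow> nat" where
  "tri_count E e = card {S \<in> triangles E. e \<subseteq> S}"

text \<open>The maximum over all edges, which is \<^term>\<open>\<infinity> :: ereal\<close> if the numbers of triangles
  are unbounded on an infinite graph.\<close>

definition max_tri :: "'a set set \<Rightarrow> ereal" where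
  "max_tri E = (SUP e\<in>E. ereal (real (tri_count E e)))"

lemma max_tri_eq:
  assumes "e \<in> E" and "\<And>e'. e' \<in> E \<Longrightarrow> tri_count E e' \<le> tri_count E e"
  shows "max_tri E = ereal (real (tri_count E e))"
  unfolding max_tri_def
  by (rule antisym) (use assms in \<open>auto intro!: SUP_least SUP_upper\<close>)

context lf_graph
begin

lemma nbrs_in_V: "x \<in> V \<Longrightarrow> nbrs E x \<subseteq> V - {x}"
  using simple_edges by (fastforce simp: nbrs_def)

lemma finite_triangles:
  assumes "e \<in> E"
  shows "finite {S \<in> triangles E. e \<subseteq> S}"
proof -
  from assms simple_edges obtain x y where e: "e = {x, y}" "x \<in> V"
    by (metis card_2_iff insert_subset)
  have "{S \<in> triangles E. e \<subseteq> S} \<subseteq> Pow (insert x (nbrs E x))"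
    using e by (auto simp: triangles_def nbrs_def)
  then show ?thesis
    using locally_finite[OF \<open>x \<in> V\<close>] by (meson finite_Pow_iff finite_insert finite_subset)
qed

lemma ric_greatest:
  assumes "curv_bound V E K0"
  obtains K where "ric V E = ereal K" "curv_bound V E K"
    "\<And>K'. curv_bound V E K' \<Longrightarrow> K' \<le> K"
proof -
  let ?S = "{K. curv_bound V E K}"
  have ne: "?S \<noteq> {}" using assms by auto
  obtain x where x: "x \<in> V" using nonempty by blast
  define g where "g = (\<lambda>y. if y = x then 0 else 1 :: real)"
  have "Gam E g g x = 1/2 * (\<Sum>y\<in>nbrs E x. 1)"
    unfolding Gam_def using nbrs_in_V[OF x]
    by (intro arg_cong2[where f = "(*)"] sum.cong) (auto simp: g_def)
  moreover have "card (nbrs E x) > 0"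
    using locally_finite[OF x] no_isolated[OF x] by (simp add: card_gt_0_iff)
  ultimately have pos: "Gam E g g x > 0" by simp
  have "K \<le> Gam2 E g x / Gam E g g x" if "K \<in> ?S" for K
    using that pos x by (auto simp: curv_bound_def pos_le_divide_eq)
  then have bdd: "bdd_above ?S" by (auto simp: bdd_above_def)
  have bound: "curv_bound V E (Sup ?S)"
  proof (subst curv_bound_def, intro allI ballI)
    fix f x assume x: "x \<in> V"
    have "Gam E f f x \<ge> 0" by (simp add: Gam_def sum_nonneg)
    then consider "Gam E f f x = 0" | "Gam E f f x > 0" by linarith
    then show "Gam2 E f x \<ge> Sup ?S * Gam E f f x"
    proof cases
      case 1
      have "K0 * Gam E f f x \<le> Gam2 E f x"
        using assms x by (simp add: curv_bound_def)
      with 1 show ?thesis by simp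
    next
      case 2
      have "Sup ?S \<le> Gam2 E f x / Gam E f f x"
        using x 2 by (intro cSup_least[OF ne]) (auto simp: curv_bound_def pos_le_divide_eq)
      with 2 show ?thesis by (simp add: pos_le_divide_eq)
    qed
  qed
  have up: "K' \<le> Sup ?S" if "curv_bound V E K'" for K'
    using that bdd by (auto intro: cSup_upper)
  have "ric V E = ereal (Sup ?S)"
    unfolding ric_def by (rule antisym) (use bound up in \<open>auto intro!: Sup_least Sup_upper\<close>)
  then show ?thesis using bound up that by blast
qed

end

end

theory Submission
  imports Defs
begin

text \<open>Test the curvature inequality at a vertex \<open>x\<close> of minimal degree with \<open>f = min (d(x, \<cdot>)) 2\<close>.
  Writing \<open>t(v)\<close> for the number of triangles on the edge \<open>{x, v}\<close>, one finds
  \<open>2 \<Gamma>\<^sub>2(f)(x) = (\<Sum>v\<sim>x. 2 + t(v)/2 + (deg x - deg v)/2)\<close> and \<open>2 \<Gamma>(f)(x) = deg x\<close>. By minimality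
  of \<open>deg x\<close> every summand is at most \<open>2 + T/2\<close>.\<close>

text \<open>The value 2 also covers vertices farther away or in another component, so no path metric
  has to be set up; \<open>Gam2\<close> at \<open>x\<close> sees only the ball of radius 2.\<close>

definition capped_dist :: "'a set set \<Rightarrow> 'a \<Rightarrow> 'a \<Rightarrow> real" where
  "capped_dist E x y = (if y = x then 0 else if y \<in> nbrs E x then 1 else 2)"

lemma nbrs_sym: "y \<in> nbrs E x \<longleftrightarrow> x \<in> nbrs E y"
  by (simp add: nbrs_def insert_commute)

context lf_graph
begin

lemma not_nbrs_self: "x \<in> V \<Longrightarrow> x \<notin> nbrs E x"
  using nbrs_in_V by blast

text \<open>Each common neighbour \<open>y\<close> completes the edge to a triangle
  \<open>{x, v, y}\<close>, and distinct \<open>y\<close> give distinct triangles.\<close>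

lemma card_common_nbrs_le_tri_count:
  assumes x: "x \<in> V" and v: "v \<in> nbrs E x"
  shows "card (nbrs E x \<inter> nbrs E v) \<le> tri_count E {x, v}"
  unfolding tri_count_def
proof (rule card_inj_on_le[where f = "\<lambda>y. {x, v, y}"])
  have vV: "v \<in> V" "v \<noteq> x" using nbrs_in_V[OF x] v by auto
  have ne: "y \<noteq> x" "y \<noteq> v" if "y \<in> nbrs E x \<inter> nbrs E v" for y
    using that not_nbrs_self x vV by auto
  show "inj_on (\<lambda>y. {x, v, y}) (nbrs E x \<inter> nbrs E v)"
    using ne by (intro inj_onI) blast
  show "(\<lambda>y. {x, v, y}) ` (nbrs E x \<inter> nbrs E v) \<subseteq> {S \<in> triangles E. {x, v} \<subseteq> S}"
  proof clarify
    fix y assume y: "y \<in> nbrs E x" "y \<in> nbrs E v"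
    then have "card {x, v, y} = 3" using ne[of y] vV by auto
    moreover have "{x, y} \<in> E" "{v, y} \<in> E" "{x, v} \<in> E"
      "{y, x} \<in> E" "{y, v} \<in> E" "{v, x} \<in> E"
      using y v by (auto simp: nbrs_def insert_commute)
    ultimately show "{x, v, y} \<in> triangles E \<and> {x, v} \<subseteq> {x, v, y}"
      by (auto simp: triangles_def)
  qed
  show "finite {S \<in> triangles E. {x, v} \<subseteq> S}"
    using v by (intro finite_triangles) (simp add: nbrs_def)
qed

lemma sum_nbrs_capped_dist:
  fixes h :: "real \<Rightarrow> real"
  assumes x: "x \<in> V"
  shows "(\<Sum>y\<in>nbrs E x. h (capped_dist E x y)) = card (nbrs E x) * h 1"
proof -
  have "(\<Sum>y\<in>nbrs E x. h (capped_dist E x y)) = (\<Sum>y\<in>nbrs E x. h 1)"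
    using not_nbrs_self[OF x] by (intro sum.cong) (auto simp: capped_dist_def)
  then show ?thesis by simp
qed

text \<open>The neighbours of \<open>v\<close> are sorted by their distance 0, 1 or 2 from
  \<open>x\<close>: the vertex \<open>x\<close> itself, the \<open>t\<close> common neighbours, and
  the rest. Keeping \<open>h\<close> arbitrary lets one count serve both \<open>Gam\<close> and
  \<open>laplacian\<close> at \<open>v\<close>.\<close>

lemma sum_nbrs_nbr_capped_dist:
  fixes h :: "real \<Rightarrow> real"
  assumes x: "x \<in> V" and v: "v \<in> nbrs E x"
  defines "t \<equiv> real (card (nbrs E x \<inter> nbrs E v))"
  shows "(\<Sum>y\<in>nbrs E v. h (capped_dist E x y))
    = h 0 + t * h 1 + (real (card (nbrs E v)) - 1 - t) * h 2"
proof -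
  define A where "A = nbrs E x \<inter> nbrs E v"
  define B where "B = nbrs E v - nbrs E x - {x}"
  have "v \<in> V" using nbrs_in_V[OF x] v by auto
  then have "finite (nbrs E v)" by (rule locally_finite)
  then have fin: "finite A" "finite B" by (auto simp: A_def B_def)
  have split: "nbrs E v = insert x (A \<union> B)"
    using v by (auto simp: A_def B_def nbrs_sym[of v])
  have x_notin: "x \<notin> A \<union> B" and disj: "A \<inter> B = {}"
    using not_nbrs_self[OF x] by (auto simp: A_def B_def)
  have A: "(\<Sum>y\<in>A. h (capped_dist E x y)) = (\<Sum>y\<in>A. h 1)"
    using not_nbrs_self[OF x] by (intro sum.cong) (auto simp: A_def capped_dist_def)
  have B: "(\<Sum>y\<in>B. h (capped_dist E x y)) = (\<Sum>y\<in>B. h 2)"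
    by (intro sum.cong) (auto simp: B_def capped_dist_def)
  have "(\<Sum>y\<in>nbrs E v. h (capped_dist E x y)) = h 0 + card A * h 1 + card B * h 2"
    unfolding split using fin x_notin disj
    by (simp add: sum.union_disjoint A B) (simp add: capped_dist_def)
  moreover have "card (nbrs E v) = 1 + card A + card B"
    unfolding split using fin x_notin disj by (simp add: card_Un_disjoint)
  ultimately show ?thesis by (simp add: t_def A_def[symmetric])
qed

lemma Gam_capped_dist:
  assumes x: "x \<in> V"
  shows "Gam E (capped_dist E x) (capped_dist E x) x = card (nbrs E x) / 2"
  using sum_nbrs_capped_dist[OF x, of "\<lambda>a. (0 - a) * (0 - a)"]
  by (simp add: Gam_def capped_dist_def[of E x x])

lemma Gam2_capped_dist:
  assumes x: "x \<in> V"
  shows "2 * Gam2 E (capped_dist E x) x = (\<Sum>v\<in>nbrs E x.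
    2 + real (card (nbrs E x \<inter> nbrs E v)) / 2
      + (real (card (nbrs E x)) - real (card (nbrs E v))) / 2)"
proof -
  let ?f = "capped_dist E x"
  have fx: "?f x = 0" by (simp add: capped_dist_def)
  have fv: "?f v = 1" if "v \<in> nbrs E x" for v
    using that not_nbrs_self[OF x] by (auto simp: capped_dist_def)
  have lap_x: "laplacian E ?f x = card (nbrs E x)"
    using sum_nbrs_capped_dist[OF x, of "\<lambda>a. a - 0"] by (simp add: laplacian_def fx)
  \<comment> \<open>Doubling cancels the factors 1/2, and both terms of \<open>Gam2\<close> become
    sums over the same neighbours, which merge into one.\<close>
  have "2 * Gam2 E ?f x = (\<Sum>v\<in>nbrs E x. Gam E ?f ?f v - Gam E ?f ?f x
      - (?f x - ?f v) * (laplacian E ?f x - laplacian E ?f v))"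
    by (simp add: Gam2_def laplacian_def[of E "Gam E ?f ?f"] Gam_def[of E ?f "laplacian E ?f"]
        sum_subtractf)
  also have "\<dots> = (\<Sum>v\<in>nbrs E x.
    2 + real (card (nbrs E x \<inter> nbrs E v)) / 2
      + (real (card (nbrs E x)) - real (card (nbrs E v))) / 2)"
  proof (intro sum.cong refl)
    fix v assume v: "v \<in> nbrs E x"
    let ?t = "real (card (nbrs E x \<inter> nbrs E v))"
    \<comment> \<open>The square \<open>(1 - a) * (1 - a)\<close> is 1, 0, 1 at distances 0, 1, 2,
      so only common neighbours drop out.\<close>
    have "Gam E ?f ?f v = (real (card (nbrs E v)) - ?t) / 2"
      using sum_nbrs_nbr_capped_dist[OF x v, of "\<lambda>a. (1 - a) * (1 - a)"]
      by (simp add: Gam_def fv[OF v])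
    \<comment> \<open>Here the increments are -1, 0, 1: besides not counting itself among the
      vertices at distance 2, \<open>x\<close> contributes -1, hence the 2.\<close>
    moreover have "laplacian E ?f v = real (card (nbrs E v)) - 2 - ?t"
      using sum_nbrs_nbr_capped_dist[OF x v, of "\<lambda>a. a - 1"]
      by (simp add: laplacian_def fv[OF v])
    ultimately show "Gam E ?f ?f v - Gam E ?f ?f x
        - (?f x - ?f v) * (laplacian E ?f x - laplacian E ?f v)
      = 2 + ?t / 2 + (real (card (nbrs E x)) - real (card (nbrs E v))) / 2"
      by (simp add: Gam_capped_dist[OF x] lap_x fx fv[OF v] field_simps)
  qed
  finally show ?thesis .
qed

text \<open>Stated for any real upper bound \<open>T\<close>, so that extended reals enter only at
  the end.\<close>

lemma curv_bound_le:
  assumes K: "curv_bound V E K" and T: "\<And>e. e \<in> E \<Longrightarrow> real (tri_count E e) \<le> T"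
  shows "K \<le> 2 + T / 2"
proof -
  \<comment> \<open>Degrees are natural numbers, so a minimum is attained even if \<open>V\<close>
    is infinite.\<close>
  obtain x where x: "x \<in> V" and min: "\<And>y. y \<in> V \<Longrightarrow> card (nbrs E x) \<le> card (nbrs E y)"
    using ex_has_least_nat[of "\<lambda>y. y \<in> V" _ "\<lambda>y. card (nbrs E y)"] nonempty by blast
  let ?d = "real (card (nbrs E x))"
  have "K * Gam E (capped_dist E x) (capped_dist E x) x \<le> Gam2 E (capped_dist E x) x"
    using K x unfolding curv_bound_def by blast
  then have "K * ?d \<le> 2 * Gam2 E (capped_dist E x) x"
    by (simp add: Gam_capped_dist[OF x])
  also have "\<dots> \<le> (\<Sum>v\<in>nbrs E x. 2 + T / 2)"
    unfolding Gam2_capped_dist[OF x]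
  proof (rule sum_mono)
    fix v assume v: "v \<in> nbrs E x"
    have "?d \<le> real (card (nbrs E v))" using nbrs_in_V[OF x] v min[of v] by auto
    moreover have "real (card (nbrs E x \<inter> nbrs E v)) \<le> T"
      using card_common_nbrs_le_tri_count[OF x v] T[of "{x, v}"] v by (simp add: nbrs_def)
    ultimately show "2 + real (card (nbrs E x \<inter> nbrs E v)) / 2
      + (?d - real (card (nbrs E v))) / 2 \<le> 2 + T / 2" by (simp add: field_simps)
  qed
  also have "\<dots> = (2 + T / 2) * ?d" by simp
  finally have "K * ?d \<le> (2 + T / 2) * ?d" .
  moreover have "?d > 0"
    using locally_finite[OF x] no_isolated[OF x] by (simp add: card_gt_0_iff)
  ultimately show ?thesis by simp
qed

end

theorem theorem2:
  fixes V :: "'a set" and E :: "'a set set"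
  assumes "lf_graph V E"
  shows "ric V E \<le> 2 + max_tri E / 2"
proof -
  interpret lf_graph V E by fact
  have upper: "ereal (real (tri_count E e)) \<le> max_tri E" if "e \<in> E" for e
    unfolding max_tri_def using that by (rule SUP_upper)
  show ?thesis
  proof (cases "max_tri E")
    case (real T)
    have "K \<le> 2 + T / 2" if "curv_bound V E K" for K
      using that upper real by (intro curv_bound_le) auto
    \<comment> \<open>This includes the case of no real curvature bound, where the supremum is
      -\<infinity>.\<close>
    then have "ric V E \<le> ereal (2 + T / 2)"
      unfolding ric_def by (auto intro!: Sup_least)
    also have "\<dots> = 2 + max_tri E / 2"
      unfolding real by simp
    finally show ?thesis .
  next
    case PInf
    then show ?thesis by simp
  next
    \<comment> \<open>A supremum of -\<infinity> would require an empty edge set, but a vertex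
      exists and is not isolated.\<close>
    case MInf
    obtain x y where "x \<in> V" "{x, y} \<in> E"
      using nonempty no_isolated by (fastforce simp: nbrs_def)
    then show ?thesis using upper MInf by fastforce
  qed
qed

end
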